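(* Let $L$ be either of the sequent calculi $\mathrm{sMC}^*$, $\mathrm{sCN}^*$. Then the rule (cut) is admissible in cut-free $L$. That is, for all finite sets $\Gamma,\Sigma$ of formulas and all formulas $\alpha,\gamma$: if $\Gamma\Rightarrow\alpha$ and $\alpha,\Sigma\Rightarrow\gamma$ are both provable in $L-(\mathrm{cut})$, then $\Gamma,\Sigma\Rightarrow\gamma$ is provable in $L-(\mathrm{cut})$.
   Context: Formulas are built from countably many propositional variables $p,q,\dots$ using the binary connectives $\land,\lor,\to$ and the unary connective $\sim$. A sequent is an expression $\Gamma\Rightarrow\gamma$ with $\Gamma$ a finite (possibly empty) set of formulas and $\gamma$ a single formula; $\alpha,\Gamma$ means $\{\alpha\}\cup\Gamma$ and $\Gamma,\Delta$ means $\Gamma\cup\Delta$. The calculus $\mathrm{sC}$ has the following initial sequents and rules ($p$ any propositional variable; $\alpha,\beta,\gamma$ any formulas; $\Gamma,\Delta,\Sigma$ any finite sets of formulas). Initial sequents: (init1) $p,\Gamma\Rightarrow p$; (init2) $\sim p,\Gamma\Rightarrow\sim p$. (cut): from $\Gamma\Rightarrow\alpha$ and $\alpha,\Sigma\Rightarrow\gamma$ infer $\Gamma,\Sigma\Rightarrow\gamma$. ($\to$left): from $\Gamma\Rightarrow\alpha$ and $\beta,\Delta\Rightarrow\gamma$ infer $\alpha\to\beta,\Gamma,\Delta\Rightarrow\gamma$. ($\to$right): from $\alpha,\Gamma\Rightarrow\beta$ infer $\Gamma\Rightarrow\alpha\to\beta$. ($\land$left): from $\alpha,\beta,\Gamma\Rightarrow\gamma$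 infer $\alpha\land\beta,\Gamma\Rightarrow\gamma$. ($\land$right): from $\Gamma\Rightarrow\alpha$ and $\Gamma\Rightarrow\beta$ infer $\Gamma\Rightarrow\alpha\land\beta$. ($\lor$left): from $\alpha,\Gamma\Rightarrow\gamma$ and $\beta,\Gamma\Rightarrow\gamma$ infer $\alpha\lor\beta,\Gamma\Rightarrow\gamma$. ($\lor$right1), ($\lor$right2): from $\Gamma\Rightarrow\alpha$ (respectively $\Gamma\Rightarrow\beta$) infer $\Gamma\Rightarrow\alpha\lor\beta$. ($\sim$left): from $\alpha,\Gamma\Rightarrow\gamma$ infer $\sim\sim\alpha,\Gamma\Rightarrow\gamma$. ($\sim$right): from $\Gamma\Rightarrow\alpha$ infer $\Gamma\Rightarrow\sim\sim\alpha$. ($\sim\to$left): from $\Gamma\Rightarrow\alpha$ and $\sim\beta,\Delta\Rightarrow\gamma$ infer $\sim(\alpha\to\beta),\Gamma,\Delta\Rightarrow\gamma$. ($\sim\to$right): from $\alpha,\Gamma\Rightarrow\sim\beta$ infer $\Gamma\Rightarrow\sim(\alpha\to\beta)$. ($\sim\land$left): from $\sim\alpha,\Gamma\Rightarrow\gamma$ and $\sim\beta,\Gamma\Rightarrow\gamma$ infer $\sim(\alpha\land\beta),\Gamma\Rightarrow\gamma$. ($\sim\land$right1), ($\sim\land$right2): from $\Gamma\Rightarrow\sim\alpha$ (respectively $\Gamma\Rightarrow\sim\beta$) infer $\Gamma\Rightarrow\sim(\alpha\land\beta)$. ($\sim\lor$left): from $\sim\alpha,\sim\beta,\Gamma\Rightarrow\gamma$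 infer $\sim(\alpha\lor\beta),\Gamma\Rightarrow\gamma$. ($\sim\lor$right): from $\Gamma\Rightarrow\sim\alpha$ and $\Gamma\Rightarrow\sim\beta$ infer $\Gamma\Rightarrow\sim(\alpha\lor\beta)$. Additional rules: (ex-middle): from $\sim\alpha,\Gamma\Rightarrow\gamma$ and $\alpha,\Gamma\Rightarrow\gamma$ infer $\Gamma\Rightarrow\gamma$. (g-ex-middle): from $\alpha\to\beta,\Gamma\Rightarrow\gamma$ and $\alpha,\Gamma\Rightarrow\gamma$ infer $\Gamma\Rightarrow\gamma$. $\mathrm{sMC}^*=\mathrm{sC}+$(g-ex-middle); $\mathrm{sCN}^*=\mathrm{sC}+$(ex-middle)$+$(g-ex-middle). "Cut-free $L$", written $L-(\mathrm{cut})$, is $L$ without the rule (cut). A rule is admissible in a calculus if, for every instance of it, provability of all premises in the calculus implies provability of the conclusion in the calculus. *)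

theory Defs
  imports Main "HOL-Library.FSet"
begin

datatype form =
    Var nat
  | Neg form  ("\<sim> _" [90] 90)
  | Conj form form  (infixr "\<^bold>\<and>" 75)
  | Disj form form  (infixr "\<^bold>\<or>" 70)
  | Imp form form  (infixr "\<^bold>\<rightarrow>" 65)

datatype sequent = Sequent "form fset" form  (infix "\<turnstile>" 55)

datatype rule_name =
    Init1 | Init2 | Cut
  | ImpL | ImpR | ConjL | ConjR | DisjL | DisjR1 | DisjR2
  | NegL | NegR
  | NegImpL | NegImpR | NegConjL | NegConjR1 | NegConjR2 | NegDisjL | NegDisjR
  | ExMiddle | GExMiddle

text \<open>
  \<open>inst r Ps S\<close>: inferring \<open>S\<close> from the list of premises \<open>Ps\<close> is an instance of the rule \<open>r\<close>.
  Initial sequents are rules without premises. The context \<open>\<alpha>, \<Gamma>\<close> is \<open>finsert \<alpha> \<Gamma>\<close>, where \<open>\<alpha>\<close> may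
  already occur in \<open>\<Gamma>\<close>.
\<close>

inductive inst :: "rule_name \<Rightarrow> sequent list \<Rightarrow> sequent \<Rightarrow> bool" where
  Init1: "inst Init1 [] (finsert (Var p) \<Gamma> \<turnstile> Var p)"
| Init2: "inst Init2 [] (finsert (\<sim> Var p) \<Gamma> \<turnstile> \<sim> Var p)"
| Cut: "inst Cut [\<Gamma> \<turnstile> \<alpha>, finsert \<alpha> \<Sigma> \<turnstile> \<gamma>] (\<Gamma> |\<union>| \<Sigma> \<turnstile> \<gamma>)"
| ImpL: "inst ImpL [\<Gamma> \<turnstile> \<alpha>, finsert \<beta> \<Delta> \<turnstile> \<gamma>] (finsert (\<alpha> \<^bold>\<rightarrow> \<beta>) (\<Gamma> |\<union>| \<Delta>) \<turnstile> \<gamma>)"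
| ImpR: "inst ImpR [finsert \<alpha> \<Gamma> \<turnstile> \<beta>] (\<Gamma> \<turnstile> \<alpha> \<^bold>\<rightarrow> \<beta>)"
| ConjL: "inst ConjL [finsert \<alpha> (finsert \<beta> \<Gamma>) \<turnstile> \<gamma>] (finsert (\<alpha> \<^bold>\<and> \<beta>) \<Gamma> \<turnstile> \<gamma>)"
| ConjR: "inst ConjR [\<Gamma> \<turnstile> \<alpha>, \<Gamma> \<turnstile> \<beta>] (\<Gamma> \<turnstile> \<alpha> \<^bold>\<and> \<beta>)"
| DisjL: "inst DisjL [finsert \<alpha> \<Gamma> \<turnstile> \<gamma>, finsert \<beta> \<Gamma> \<turnstile> \<gamma>] (finsert (\<alpha> \<^bold>\<or> \<beta>) \<Gamma> \<turnstile> \<gamma>)"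
| DisjR1: "inst DisjR1 [\<Gamma> \<turnstile> \<alpha>] (\<Gamma> \<turnstile> \<alpha> \<^bold>\<or> \<beta>)"
| DisjR2: "inst DisjR2 [\<Gamma> \<turnstile> \<beta>] (\<Gamma> \<turnstile> \<alpha> \<^bold>\<or> \<beta>)"
| NegL: "inst NegL [finsert \<alpha> \<Gamma> \<turnstile> \<gamma>] (finsert (\<sim> \<sim> \<alpha>) \<Gamma> \<turnstile> \<gamma>)"
| NegR: "inst NegR [\<Gamma> \<turnstile> \<alpha>] (\<Gamma> \<turnstile> \<sim> \<sim> \<alpha>)"
| NegImpL: "inst NegImpL [\<Gamma> \<turnstile> \<alpha>, finsert (\<sim> \<beta>) \<Delta> \<turnstile> \<gamma>]
    (finsert (\<sim> (\<alpha> \<^bold>\<rightarrow> \<beta>)) (\<Gamma> |\<union>| \<Delta>) \<turnstile> \<gamma>)"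
| NegImpR: "inst NegImpR [finsert \<alpha> \<Gamma> \<turnstile> \<sim> \<beta>] (\<Gamma> \<turnstile> \<sim> (\<alpha> \<^bold>\<rightarrow> \<beta>))"
| NegConjL: "inst NegConjL [finsert (\<sim> \<alpha>) \<Gamma> \<turnstile> \<gamma>, finsert (\<sim> \<beta>) \<Gamma> \<turnstile> \<gamma>]
    (finsert (\<sim> (\<alpha> \<^bold>\<and> \<beta>)) \<Gamma> \<turnstile> \<gamma>)"
| NegConjR1: "inst NegConjR1 [\<Gamma> \<turnstile> \<sim> \<alpha>] (\<Gamma> \<turnstile> \<sim> (\<alpha> \<^bold>\<and> \<beta>))"
| NegConjR2: "inst NegConjR2 [\<Gamma> \<turnstile> \<sim> \<beta>] (\<Gamma> \<turnstile> \<sim> (\<alpha> \<^bold>\<and> \<beta>))"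
| NegDisjL: "inst NegDisjL [finsert (\<sim> \<alpha>) (finsert (\<sim> \<beta>) \<Gamma>) \<turnstile> \<gamma>]
    (finsert (\<sim> (\<alpha> \<^bold>\<or> \<beta>)) \<Gamma> \<turnstile> \<gamma>)"
| NegDisjR: "inst NegDisjR [\<Gamma> \<turnstile> \<sim> \<alpha>, \<Gamma> \<turnstile> \<sim> \<beta>] (\<Gamma> \<turnstile> \<sim> (\<alpha> \<^bold>\<or> \<beta>))"
| ExMiddle: "inst ExMiddle [finsert (\<sim> \<alpha>) \<Gamma> \<turnstile> \<gamma>, finsert \<alpha> \<Gamma> \<turnstile> \<gamma>] (\<Gamma> \<turnstile> \<gamma>)"
| GExMiddle: "inst GExMiddle [finsert (\<alpha> \<^bold>\<rightarrow> \<beta>) \<Gamma> \<turnstile> \<gamma>, finsert \<alpha> \<Gamma> \<turnstile> \<gamma>] (\<Gamma> \<turnstile> \<gamma>)"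

text \<open>
  Calculi are sets of rule names rather than sets of instances, because an inference can be an
  instance of several rules: from \<open>\<Gamma> \<turnstile> \<alpha>\<close> and \<open>\<alpha>, \<alpha> \<^bold>\<rightarrow> \<alpha>, \<Delta> \<turnstile> \<gamma>\<close>, the sequent
  \<open>\<alpha> \<^bold>\<rightarrow> \<alpha>, \<Gamma>, \<Delta> \<turnstile> \<gamma>\<close> follows both by \<open>Cut\<close> and by \<open>ImpL\<close>. Only the former is lost in a cut-free
  calculus.
\<close>

type_synonym calculus = "rule_name set"

inductive provable :: "calculus \<Rightarrow> sequent \<Rightarrow> bool" for L :: calculus where
  infer: "\<lbrakk>r \<in> L; inst r Ps S; \<And>P. P \<in> set Ps \<Longrightarrow> provable L P\<rbrakk> \<Longrightarrow> provable L S"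

definition sC :: calculus where
  "sC = {Init1, Init2, Cut, ImpL, ImpR, ConjL, ConjR, DisjL, DisjR1, DisjR2, NegL, NegR,
    NegImpL, NegImpR, NegConjL, NegConjR1, NegConjR2, NegDisjL, NegDisjR}"

definition sMC_star :: calculus where
  "sMC_star = sC \<union> {GExMiddle}"

definition sCN_star :: calculus where
  "sCN_star = sC \<union> {ExMiddle, GExMiddle}"

definition cut_free :: "calculus \<Rightarrow> calculus" where
  "cut_free L = L - {Cut}"

definition admissible :: "rule_name \<Rightarrow> calculus \<Rightarrow> bool" where
  "admissible r L \<longleftrightarrow> (\<forall>Ps S. inst r Ps S \<longrightarrow> (\<forall>P \<in> set Ps. provable L P) \<longrightarrow> provable L S)"

lemma admissible_Cut_iff:
  "admissible Cut L \<longleftrightarrow>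
    (\<forall>\<Gamma> \<Sigma> \<alpha> \<gamma>. provable L (\<Gamma> \<turnstile> \<alpha>) \<longrightarrow> provable L (finsert \<alpha> \<Sigma> \<turnstile> \<gamma>) \<longrightarrow> provable L (\<Gamma> |\<union>| \<Sigma> \<turnstile> \<gamma>))"
proof
  assume adm: "admissible Cut L"
  show "\<forall>\<Gamma> \<Sigma> \<alpha> \<gamma>. provable L (\<Gamma> \<turnstile> \<alpha>) \<longrightarrow> provable L (finsert \<alpha> \<Sigma> \<turnstile> \<gamma>) \<longrightarrow> provable L (\<Gamma> |\<union>| \<Sigma> \<turnstile> \<gamma>)"
  proof (intro allI impI)
    fix \<Gamma> \<Sigma> \<alpha> \<gamma>
    assume "provable L (\<Gamma> \<turnstile> \<alpha>)" "provable L (finsert \<alpha> \<Sigma> \<turnstile> \<gamma>)"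
    then show "provable L (\<Gamma> |\<union>| \<Sigma> \<turnstile> \<gamma>)"
      using adm inst.Cut[of \<Gamma> \<alpha> \<Sigma> \<gamma>] unfolding admissible_def by fastforce
  qed
next
  assume cut: "\<forall>\<Gamma> \<Sigma> \<alpha> \<gamma>. provable L (\<Gamma> \<turnstile> \<alpha>) \<longrightarrow> provable L (finsert \<alpha> \<Sigma> \<turnstile> \<gamma>) \<longrightarrow>
    provable L (\<Gamma> |\<union>| \<Sigma> \<turnstile> \<gamma>)"
  show "admissible Cut L"
    unfolding admissible_def
  proof (intro allI impI)
    fix Ps S
    assume "inst Cut Ps S" and prems: "\<forall>P \<in> set Ps. provable L P"
    then obtain \<Gamma> \<Sigma> \<alpha> \<gamma> where "Ps = [\<Gamma> \<turnstile> \<alpha>, finsert \<alpha> \<Sigma> \<turnstile> \<gamma>]" "S = (\<Gamma> |\<union>| \<Sigma> \<turnstile> \<gamma>)"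
      by (cases rule: inst.cases) auto
    then show "provable L S"
      using cut prems by auto
  qed
qed

end

(* Generalised excluded middle absorbs cut: from \<Gamma> \<Rightarrow> \<alpha> and \<alpha>, \<Sigma> \<Rightarrow> \<gamma> the left rule for implication
   yields \<alpha> \<rightarrow> \<alpha>, \<Gamma>, \<Sigma> \<Rightarrow> \<gamma>, while weakening yields \<alpha>, \<Gamma>, \<Sigma> \<Rightarrow> \<gamma>. These are the premises of the instance
   \<beta> := \<alpha> of (g-ex-middle), whose conclusion is \<Gamma>, \<Sigma> \<Rightarrow> \<gamma>. *)
theory Submission
  imports Defs
begin

primrec weaken :: "form fset \<Rightarrow> sequent \<Rightarrow> sequent" where
  "weaken \<Theta> (\<Gamma> \<turnstile> \<gamma>) = (\<Gamma> |\<union>| \<Theta> \<turnstile> \<gamma>)"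

text \<open>Every rule is schematic in its contexts, so the same rule applies once each context is
  enlarged by \<Theta>; initial sequents absorb it.\<close>

lemma inst_weaken:
  assumes "inst r Ps S"
  shows "inst r (map (weaken \<Theta>) Ps) (weaken \<Theta> S)"
proof -
  \<comment> \<open>For rules that merge two contexts, such as \<open>ImpL\<close>, both premises
    receive \<Theta>, and their union absorbs the duplicate.\<close>
  have union: "(\<Gamma> |\<union>| \<Delta>) |\<union>| \<Theta> = (\<Gamma> |\<union>| \<Theta>) |\<union>| (\<Delta> |\<union>| \<Theta>)" for \<Gamma> \<Delta>
    by auto
  show ?thesis
    using assms by cases (simp_all add: union inst.intros del: sup_assoc)
qed

lemma provable_weaken:
  assumes "provable L S"
  shows "provable L (weaken \<Theta> S)"
  using assms
proof induction
  case (infer r Ps S)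
  show ?case
    by (rule provable.infer[OF infer.hyps(1) inst_weaken[OF infer.hyps(2)]])
      (use infer.IH in auto)
qed

text \<open>Only these two rules are asked of \<open>L\<close>, and both survive the removal of
  \<open>Cut\<close>, so one argument serves both cut-free calculi.\<close>

lemma admissible_Cut_if_GExMiddle:
  assumes "ImpL \<in> L" "GExMiddle \<in> L"
  shows "admissible Cut L"
  unfolding admissible_Cut_iff
proof (intro allI impI)
  fix \<Gamma> \<Sigma> \<alpha> \<gamma>
  assume left: "provable L (\<Gamma> \<turnstile> \<alpha>)" and right: "provable L (finsert \<alpha> \<Sigma> \<turnstile> \<gamma>)"
  have imp: "provable L (finsert (\<alpha> \<^bold>\<rightarrow> \<alpha>) (\<Gamma> |\<union>| \<Sigma>) \<turnstile> \<gamma>)"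
    by (rule provable.infer[OF assms(1) inst.ImpL]) (use left right in auto)
  have "provable L (finsert \<alpha> (\<Gamma> |\<union>| \<Sigma>) \<turnstile> \<gamma>)"
    using provable_weaken[OF right, of \<Gamma>] by (simp add: sup_commute)
  with imp show "provable L (\<Gamma> |\<union>| \<Sigma> \<turnstile> \<gamma>)"
    by (intro provable.infer[OF assms(2) inst.GExMiddle]) auto
qed

theorem theorem2p13:
  fixes L :: calculus
  assumes "L \<in> {sMC_star, sCN_star}"
  shows "admissible Cut (cut_free L)"
  by (rule admissible_Cut_if_GExMiddle)
    (use assms in \<open>auto simp: cut_free_def sMC_star_def sCN_star_def sC_def\<close>)

end
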